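(* Every log-concave formal power series $g(x)\in 1+x\mathbb{Z}_{\ge 0}[[x]]$ is a regular semi-upho function.
   Context: A formal power series $\sum_{i\ge 0}a_ix^i$ is log-concave if $a_i\ge 0$ and $a_ia_{i+2}\le a_{i+1}^2$ for all $i\ge 0$, and moreover $a_j=0$ implies $a_k=0$ for all $k\ge j$. Posets are nonempty. For a poset $S$ and $s\in S$, $V_s=\{p\in S:s\le p\}$ with the induced order; $\lessdot$ is the covering relation. For posets $P',P$ with least elements $\hat 0_{P'},\hat 0_P$, an isoembedding is an injective map $\eta:P'\to P$ with $\eta(\hat 0_{P'})=\hat 0_P$ such that for any chain $C$ in $P'$ with maximum $a$ and minimum $b$, $C$ is a saturated chain with maximum $a$ and minimum $b$ if and only if $\eta(C)$ is a saturated chain with maximum $\eta(a)$ and minimum $\eta(b)$. A poset $S$ with least element $\hat 0$ is semi-upho if for every $s\in S$ there is an isoembedding $V_s\to S$. Let $\mathcal{E}_S=\{(r,s):r\lessdot s\}$ and $\mathcal{A}_S=\{s:\hat 0\lessdot s\}$. $S$ is $\mathbb{N}$-graded if $S=S_0\sqcup S_1\sqcup\cdots$ so that every maximal chain (finite or infinite) has the form $p_0\lessdot p_1\lessdot p_2\lessdot\cdots$ with $p_i\in S_i$; it is of finite type if all $S_i$ are finite, and then its rank-generating function is $\sum_{k\ge 0}|S_k|x^k$. A finite type $\mathbb{N}$-graded semi-upho poset $S$ is regular if there is a map $\mathrm{col}_S:\mathcal{E}_S\to\mathcal{A}_S$ such that (i) $\mathrm{col}_S(\hat 0,t)=t$ for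 all $t\in\mathcal{A}_S$; (ii) for every $s\in S$ there is an isoembedding $\psi_s:V_s\to S$ with $\mathrm{col}_S(u,v)=\mathrm{col}_S(\psi_s(u),\psi_s(v))$ for all $(u,v)\in\mathcal{E}_{V_s}$. A regular semi-upho function is the rank-generating function of a regular finite type $\mathbb{N}$-graded semi-upho poset. *)

theory Defs
  imports Complex_Main "HOL-Library.FuncSet" "HOL-Library.Disjoint_Sets"
    "HOL-Computational_Algebra.Formal_Power_Series"
begin

text \<open>
  A poset is represented by its (reflexive) order relation \<open>r\<close>, with \<open>(x, y) \<in> r\<close> meaning
  \<open>x \<le> y\<close>; its underlying set is \<open>Field r\<close>.
\<close>

definition poset :: "'a rel \<Rightarrow> bool" where
  "poset r \<longleftrightarrow> Partial_order r \<and> Field r \<noteq> {}"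

definition minimum_of :: "'a rel \<Rightarrow> 'a set \<Rightarrow> 'a \<Rightarrow> bool" where
  "minimum_of r A x \<longleftrightarrow> x \<in> A \<and> (\<forall>y\<in>A. (x, y) \<in> r)"

definition maximum_of :: "'a rel \<Rightarrow> 'a set \<Rightarrow> 'a \<Rightarrow> bool" where
  "maximum_of r A x \<longleftrightarrow> x \<in> A \<and> (\<forall>y\<in>A. (y, x) \<in> r)"

definition has_bottom :: "'a rel \<Rightarrow> bool" where
  "has_bottom r \<longleftrightarrow> (\<exists>x. minimum_of r (Field r) x)"

definition bottom :: "'a rel \<Rightarrow> 'a" where
  "bottom r = (THE x. minimum_of r (Field r) x)"

definition covers :: "'a rel \<Rightarrow> 'a \<Rightarrow> 'a \<Rightarrow> bool" where
  "covers r x y \<longleftrightarrow> (x, y) \<in> r \<and> x \<noteq> y \<and>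
     \<not> (\<exists>z. (x, z) \<in> r \<and> (z, y) \<in> r \<and> z \<noteq> x \<and> z \<noteq> y)"

text \<open>The principal filter \<open>V\<^sub>s\<close> with the induced order.\<close>

definition upset :: "'a rel \<Rightarrow> 'a \<Rightarrow> 'a rel" where
  "upset r s = Restr r (above r s)"

definition cover_pairs :: "'a rel \<Rightarrow> ('a \<times> 'a) set" where
  "cover_pairs r = {(x, y). covers r x y}"

definition atoms :: "'a rel \<Rightarrow> 'a set" where
  "atoms r = {s. covers r (bottom r) s}"

text \<open>
  A chain is saturated if no element of the poset lying between two of its elements can be
  added to it so that it remains a chain.
\<close>

definition saturated_chain :: "'a rel \<Rightarrow> 'a set \<Rightarrow> bool" where
  "saturated_chain r C \<longleftrightarrow> C \<in> Chains r \<and>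
     (\<forall>z \<in> Field r - C. (\<exists>x\<in>C. \<exists>y\<in>C. (x, z) \<in> r \<and> (z, y) \<in> r) \<longrightarrow> insert z C \<notin> Chains r)"

definition maximal_chain :: "'a rel \<Rightarrow> 'a set \<Rightarrow> bool" where
  "maximal_chain r C \<longleftrightarrow> C \<in> Chains r \<and> (\<forall>D \<in> Chains r. C \<subseteq> D \<longrightarrow> D = C)"

text \<open>
  As in the source, an isoembedding is not required a priori to be monotone; only chains of the
  domain are tested, and their images need not be chains unless the chain is saturated.
\<close>

definition isoembedding :: "'a rel \<Rightarrow> 'b rel \<Rightarrow> ('a \<Rightarrow> 'b) \<Rightarrow> bool" where
  "isoembedding r' r \<eta> \<longleftrightarrow>
     \<eta> \<in> Field r' \<rightarrow> Field r \<and> inj_on \<eta> (Field r') \<and> \<eta> (bottom r') = bottom r \<and>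
     (\<forall>C a b. C \<in> Chains r' \<and> maximum_of r' C a \<and> minimum_of r' C b \<longrightarrow>
        (saturated_chain r' C \<longleftrightarrow>
         saturated_chain r (\<eta> ` C) \<and> maximum_of r (\<eta> ` C) (\<eta> a) \<and> minimum_of r (\<eta> ` C) (\<eta> b)))"

definition semi_upho :: "'a rel \<Rightarrow> bool" where
  "semi_upho r \<longleftrightarrow> poset r \<and> has_bottom r \<and>
     (\<forall>s \<in> Field r. \<exists>\<eta>. isoembedding (upset r s) r \<eta>)"

text \<open>
  \<open>L i\<close> is the \<open>i\<close>-th rank level. The two disjuncts are the finite and the infinite maximal
  chains; levels may be empty.
\<close>

definition N_graded :: "'a rel \<Rightarrow> (nat \<Rightarrow> 'a set) \<Rightarrow> bool" where
  "N_graded r L \<longleftrightarrow> (\<Union>i. L i) = Field r \<and> disjoint_family L \<and>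
     (\<forall>C. maximal_chain r C \<longrightarrow>
        (\<exists>p n. C = p ` {..n} \<and> (\<forall>i\<le>n. p i \<in> L i) \<and> (\<forall>i<n. covers r (p i) (p (Suc i)))) \<or>
        (\<exists>p. C = range p \<and> (\<forall>i. p i \<in> L i) \<and> (\<forall>i. covers r (p i) (p (Suc i)))))"

definition finite_type :: "(nat \<Rightarrow> 'a set) \<Rightarrow> bool" where
  "finite_type L \<longleftrightarrow> (\<forall>i. finite (L i))"

definition rank_gf :: "(nat \<Rightarrow> 'a set) \<Rightarrow> int fps" where
  "rank_gf L = Abs_fps (\<lambda>k. int (card (L k)))"

definition regular_coloring :: "'a rel \<Rightarrow> ('a \<times> 'a \<Rightarrow> 'a) \<Rightarrow> bool" where
  "regular_coloring r col \<longleftrightarrow>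
     col \<in> cover_pairs r \<rightarrow> atoms r \<and>
     (\<forall>t \<in> atoms r. col (bottom r, t) = t) \<and>
     (\<forall>s \<in> Field r. \<exists>\<psi>. isoembedding (upset r s) r \<psi> \<and>
        (\<forall>(u, v) \<in> cover_pairs (upset r s). col (u, v) = col (\<psi> u, \<psi> v)))"

definition regular_semi_upho :: "'a rel \<Rightarrow> (nat \<Rightarrow> 'a set) \<Rightarrow> bool" where
  "regular_semi_upho r L \<longleftrightarrow> semi_upho r \<and> N_graded r L \<and> finite_type L \<and>
     (\<exists>col. regular_coloring r col)"

text \<open>
  An \<open>\<nat>\<close>-graded poset of finite type is countable, hence isomorphic to one whose underlying
  set consists of natural numbers; so letting \<open>r\<close> range over relations on \<open>nat\<close> loses nothing.
\<close>

definition regular_semi_upho_function :: "int fps \<Rightarrow> bool" where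
  "regular_semi_upho_function g \<longleftrightarrow>
     (\<exists>(r :: nat rel) L. regular_semi_upho r L \<and> g = rank_gf L)"

definition log_concave_fps :: "'a :: linordered_idom fps \<Rightarrow> bool" where
  "log_concave_fps g \<longleftrightarrow>
     (\<forall>i. fps_nth g i \<ge> 0 \<and> fps_nth g i * fps_nth g (i + 2) \<le> (fps_nth g (i + 1))\<^sup>2) \<and>
     (\<forall>j. fps_nth g j = 0 \<longrightarrow> (\<forall>k\<ge>j. fps_nth g k = 0))"

end

theory Submission
  imports Defs "HOL-Library.Sublist" "HOL-Library.Countable"
begin

text \<open>
  For a log-concave sequence \<open>a\<close>, take the words \<open>x\<^sub>0 \<dots> x\<^sub>n\<^sub>-\<^sub>1\<close> of natural numbers such that
  \<open>\<Sum>i<k. x\<^sub>i a\<^sub>i < a\<^sub>k\<close> for all \<open>k \<le> n\<close>. Division with remainder by \<open>a\<^sub>n\<close> shows inductively that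
  \<open>x \<mapsto> \<Sum>i<n. x\<^sub>i a\<^sub>i\<close> is a bijection from the words of length \<open>n\<close> onto \<open>{0, \<dots>, a\<^sub>n - 1}\<close>. Log-concavity
  gives \<open>a\<^sub>i\<^sub>-\<^sub>1 / a\<^sub>i \<le> a\<^sub>k\<^sub>-\<^sub>1 / a\<^sub>k\<close> for \<open>i \<le> k\<close>, so the condition survives deleting the first letter:
  the language is closed under factors. Any such language, ordered by prefixes, is a regular
  semi-upho tree: \<open>V\<^sub>s\<close> embeds by deleting the prefix \<open>s\<close>, and a covering pair is coloured by
  the letter it appends.
\<close>

section \<open>Isoembeddings from order embeddings\<close>

lemma bottom_eqI:
  assumes "antisym r" "minimum_of r (Field r) x"
  shows "bottom r = x"
  unfolding bottom_def
  using assms by (intro the_equality) (auto simp: minimum_of_def antisym_def)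

lemma isoembedding_if_downset_embedding:
  assumes maps: "\<eta> \<in> Field r' \<rightarrow> Field r" and inj: "inj_on \<eta> (Field r')"
    and bot: "\<eta> (bottom r') = bottom r"
    and order: "\<And>x y. x \<in> Field r' \<Longrightarrow> y \<in> Field r' \<Longrightarrow> (\<eta> x, \<eta> y) \<in> r \<longleftrightarrow> (x, y) \<in> r'"
    and down: "\<And>y z. y \<in> Field r' \<Longrightarrow> (z, \<eta> y) \<in> r \<Longrightarrow> z \<in> \<eta> ` Field r'"
  shows "isoembedding r' r \<eta>"
  unfolding isoembedding_def
proof (intro conjI allI impI)
  fix C a b
  assume C: "C \<in> Chains r' \<and> maximum_of r' C a \<and> minimum_of r' C b"
  have chain_Field: "D \<subseteq> Field r'" if "D \<in> Chains r'" for D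
    using that by (auto simp: Chains_def Field_def)
  have sub: "C \<subseteq> Field r'"
    using C chain_Field by blast
  have chain: "\<eta> ` D \<in> Chains r \<longleftrightarrow> D \<in> Chains r'" if "D \<subseteq> Field r'" for D
    using that order unfolding Chains_def by (auto simp: subset_iff)
  have ext: "maximum_of r (\<eta> ` C) (\<eta> a)" "minimum_of r (\<eta> ` C) (\<eta> b)"
    using C sub order by (auto simp: maximum_of_def minimum_of_def subset_iff)
  have "saturated_chain r' C \<longleftrightarrow> saturated_chain r (\<eta> ` C)"
  proof
    assume sat: "saturated_chain r' C"
    show "saturated_chain r (\<eta> ` C)"
      unfolding saturated_chain_def
    proof (intro conjI ballI impI)
      show "\<eta> ` C \<in> Chains r"
        using C chain sub by blast
      fix z
      assume z: "z \<in> Field r - \<eta> ` C"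
        and "\<exists>x\<in>\<eta> ` C. \<exists>y\<in>\<eta> ` C. (x, z) \<in> r \<and> (z, y) \<in> r"
      then obtain x y where xy: "x \<in> C" "y \<in> C" "(\<eta> x, z) \<in> r" "(z, \<eta> y) \<in> r"
        by blast
      then obtain w where w: "w \<in> Field r'" "z = \<eta> w"
        using down sub by blast
      have "insert w C \<notin> Chains r'"
        using sat w xy z order sub unfolding saturated_chain_def by blast
      then show "insert z (\<eta> ` C) \<notin> Chains r"
        using chain[of "insert w C"] w sub by simp
    qed
  next
    assume sat: "saturated_chain r (\<eta> ` C)"
    show "saturated_chain r' C"
      unfolding saturated_chain_def
    proof (intro conjI ballI impI)
      show "C \<in> Chains r'"
        using C by blast
      fix z
      assume z: "z \<in> Field r' - C" and "\<exists>x\<in>C. \<exists>y\<in>C. (x, z) \<in> r' \<and> (z, y) \<in> r'"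
      then have "\<exists>x\<in>\<eta> ` C. \<exists>y\<in>\<eta> ` C. (x, \<eta> z) \<in> r \<and> (\<eta> z, y) \<in> r"
        using order sub by blast
      moreover have "\<eta> z \<in> Field r - \<eta> ` C"
        using z maps inj sub by (auto simp: inj_on_def)
      ultimately have "insert (\<eta> z) (\<eta> ` C) \<notin> Chains r"
        using sat unfolding saturated_chain_def by blast
      then show "insert z C \<notin> Chains r'"
        using chain[of "insert z C"] z sub by simp
    qed
  qed
  then show "saturated_chain r' C \<longleftrightarrow>
      saturated_chain r (\<eta> ` C) \<and> maximum_of r (\<eta> ` C) (\<eta> a) \<and> minimum_of r (\<eta> ` C) (\<eta> b)"
    using ext by simp
qed (use maps inj bot in auto)

text \<open>Anything between \<open>x\<close> and \<open>y\<close> is above \<open>s\<close> by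
  transitivity, so it would already separate them inside the filter.\<close>

lemma covers_upsetD:
  assumes "trans r" and cov: "covers (upset r s) x y"
  shows "covers r x y"
  unfolding covers_def
proof (intro conjI notI)
  show "(x, y) \<in> r" "x = y \<Longrightarrow> False"
    using cov by (auto simp: covers_def upset_def)
  assume "\<exists>z. (x, z) \<in> r \<and> (z, y) \<in> r \<and> z \<noteq> x \<and> z \<noteq> y"
  then obtain z where z: "(x, z) \<in> r" "(z, y) \<in> r" "z \<noteq> x" "z \<noteq> y"
    by blast
  have "(s, x) \<in> r" "(s, y) \<in> r"
    using cov by (auto simp: covers_def upset_def above_def)
  moreover from this z have "(s, z) \<in> r"
    using \<open>trans r\<close> by (meson transD)
  ultimately have "(x, z) \<in> upset r s" "(z, y) \<in> upset r s"
    using z by (auto simp: upset_def above_def)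
  then show False
    using cov z unfolding covers_def by blast
qed

section \<open>Languages closed under factors\<close>

text \<open>The injection \<open>e\<close> transports the prefix tree to another type, eventually to \<^typ>\<open>nat\<close>.\<close>

locale factorial_language =
  fixes W :: "'a list set" and e :: "'a list \<Rightarrow> 'b"
  assumes Nil_mem: "[] \<in> W"
    and prefix_mem: "u @ v \<in> W \<Longrightarrow> u \<in> W"
    and suffix_mem: "u @ v \<in> W \<Longrightarrow> v \<in> W"
    and inj_e: "inj e"
begin

definition tree :: "'b rel" where
  "tree = {(e u, e v) | u v. u \<in> W \<and> v \<in> W \<and> prefix u v}"

definition level :: "nat \<Rightarrow> 'b set" where
  "level n = e ` {u \<in> W. length u = n}"

definition quotient :: "'a list \<Rightarrow> 'b \<Rightarrow> 'b" where
  "quotient s x = e (drop (length s) (inv e x))"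

text \<open>Colours must be atoms, and the atoms of the tree are the one-letter words; hence the
  singleton list.\<close>

definition last_letter :: "'b \<times> 'b \<Rightarrow> 'b" where
  "last_letter = (\<lambda>(x, y). e [last (inv e y)])"

lemma inv_e [simp]: "inv e (e u) = u"
  using inj_e by simp

section \<open>Order, covers and atoms of the prefix tree\<close>

lemma e_eq_iff [simp]: "e u = e v \<longleftrightarrow> u = v"
  using inj_e by (auto dest: injD)

lemma tree_iff [simp]: "(e u, e v) \<in> tree \<longleftrightarrow> u \<in> W \<and> v \<in> W \<and> prefix u v"
  by (auto simp: tree_def)

lemma tree_memE:
  assumes "(x, y) \<in> tree"
  obtains u v where "x = e u" "y = e v" "u \<in> W" "v \<in> W" "prefix u v"
  using assms by (auto simp: tree_def)

lemma prefix_closed: "prefix u v \<Longrightarrow> v \<in> W \<Longrightarrow> u \<in> W"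
  using prefix_mem by (auto simp: prefix_def)

lemma Field_tree: "Field tree = e ` W"
  by (auto simp: Field_def tree_def)

lemma poset_tree: "poset tree"
proof -
  have "trans tree"
    by (intro transI) (auto elim!: tree_memE intro: prefix_order.trans)
  moreover have "antisym tree"
    by (intro antisymI) (auto elim!: tree_memE)
  moreover have "refl_on (Field tree) tree"
    by (auto simp: refl_on_def Field_tree)
  moreover have "tree \<subseteq> Field tree \<times> Field tree"
    by (auto simp: Field_def)
  ultimately show ?thesis
    using Nil_mem by (auto simp: poset_def partial_order_on_def preorder_on_def Field_tree)
qed

lemma antisym_tree: "antisym tree"
  using poset_tree by (simp add: poset_def partial_order_on_def)

lemma minimum_tree: "minimum_of tree (Field tree) (e [])"
  using Nil_mem by (auto simp: minimum_of_def Field_tree)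

lemma bottom_tree: "bottom tree = e []"
  using antisym_tree minimum_tree by (rule bottom_eqI)

text \<open>Going from \<open>u\<close> to a proper extension \<open>u @ x # t\<close> passes
  through \<open>u @ [x]\<close>, a member of \<open>W\<close> by prefix closure; a cover leaves no
  room for a nonempty \<open>t\<close>.\<close>

lemma covers_tree: "covers tree (e u) (e v) \<longleftrightarrow> v \<in> W \<and> (\<exists>x. v = u @ [x])"
proof
  assume cov: "covers tree (e u) (e v)"
  then have uv: "u \<in> W" "v \<in> W" "prefix u v" "u \<noteq> v"
    by (auto simp: covers_def)
  then obtain x t where v: "v = u @ x # t"
    by (metis append_Nil2 neq_Nil_conv prefix_def)
  have "u @ [x] \<in> W"
    using uv(2) v prefix_mem[of "u @ [x]" t] by simp
  then have "(e u, e (u @ [x])) \<in> tree" "(e (u @ [x]), e v) \<in> tree"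
    using uv v by auto
  moreover have "e (u @ [x]) \<noteq> e u"
    by simp
  ultimately have "e (u @ [x]) = e v"
    using cov unfolding covers_def by blast
  then show "v \<in> W \<and> (\<exists>x. v = u @ [x])"
    using uv(2) by auto
next
  assume "v \<in> W \<and> (\<exists>x. v = u @ [x])"
  then show "covers tree (e u) (e v)"
    using prefix_mem by (auto simp: covers_def prefix_snoc elim!: tree_memE)
qed

lemma atoms_tree: "atoms tree = e ` {[x] | x. [x] \<in> W}"
proof -
  have "\<exists>x. t = e [x] \<and> [x] \<in> W" if "covers tree (e []) t" for t
  proof -
    have "(e [], t) \<in> tree"
      using that by (simp add: covers_def)
    then obtain v where "t = e v"
      by (auto elim!: tree_memE)
    then show ?thesis
      using that by (auto simp: covers_tree)
  qed
  then show ?thesis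
    by (fastforce simp: atoms_def bottom_tree covers_tree)
qed

section \<open>Principal filters and deletion of a prefix\<close>

lemma upset_iff:
  assumes "s \<in> W"
  shows "(e (s @ u), e (s @ v)) \<in> upset tree (e s) \<longleftrightarrow> s @ u \<in> W \<and> s @ v \<in> W \<and> prefix u v"
  using assms by (auto simp: upset_def above_def)

lemma Field_upset:
  assumes "s \<in> W"
  shows "Field (upset tree (e s)) = {e (s @ w) | w. s @ w \<in> W}"
proof (intro equalityI subsetI)
  fix x
  assume "x \<in> Field (upset tree (e s))"
  then have "(e s, x) \<in> tree"
    by (auto simp: Field_def upset_def above_def)
  then obtain v where "x = e v" "v \<in> W" "prefix s v"
    by (auto elim!: tree_memE)
  then show "x \<in> {e (s @ w) | w. s @ w \<in> W}"
    by (auto simp: prefix_def)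
next
  fix x
  assume "x \<in> {e (s @ w) | w. s @ w \<in> W}"
  then have "(x, x) \<in> upset tree (e s)"
    using upset_iff[OF assms] by auto
  then show "x \<in> Field (upset tree (e s))"
    by (rule FieldI1)
qed

lemma bottom_upset: "s \<in> W \<Longrightarrow> bottom (upset tree (e s)) = e s"
proof (rule bottom_eqI)
  show "antisym (upset tree (e s))"
    using antisym_tree by (auto simp: upset_def antisym_def)
  assume s: "s \<in> W"
  show "minimum_of (upset tree (e s)) (Field (upset tree (e s))) (e s)"
    using upset_iff[OF s, of "[]"] s
    by (auto simp: minimum_of_def Field_upset intro: exI[of _ "[]"])
qed

lemma quotient_append [simp]: "quotient s (e (s @ w)) = e w"
  by (simp add: quotient_def)

text \<open>Suffix closure makes the quotient land in \<open>W\<close>. Prefix closure makes its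
  image a down-set: if \<open>s @ v\<close> is in \<open>W\<close> and \<open>u\<close> is a prefix
  of \<open>v\<close>, then \<open>s @ u\<close> is in \<open>W\<close>.\<close>

lemma isoembedding_quotient:
  assumes s: "s \<in> W"
  shows "isoembedding (upset tree (e s)) tree (quotient s)"
proof (rule isoembedding_if_downset_embedding)
  show "quotient s \<in> Field (upset tree (e s)) \<rightarrow> Field tree"
    using suffix_mem by (auto simp: Field_upset[OF s] Field_tree)
  show "inj_on (quotient s) (Field (upset tree (e s)))"
    by (auto simp: Field_upset[OF s] inj_on_def)
  show "quotient s (bottom (upset tree (e s))) = bottom tree"
    using quotient_append[of s "[]"] by (simp add: bottom_upset[OF s] bottom_tree)
next
  fix x y
  assume "x \<in> Field (upset tree (e s))" "y \<in> Field (upset tree (e s))"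
  then obtain u v where "x = e (s @ u)" "y = e (s @ v)" "s @ u \<in> W" "s @ v \<in> W"
    by (auto simp: Field_upset[OF s])
  then show "(quotient s x, quotient s y) \<in> tree \<longleftrightarrow> (x, y) \<in> upset tree (e s)"
    using suffix_mem by (auto simp: upset_iff[OF s])
next
  fix y z
  assume y: "y \<in> Field (upset tree (e s))" and zy: "(z, quotient s y) \<in> tree"
  from y obtain v where v: "y = e (s @ v)" "s @ v \<in> W"
    by (auto simp: Field_upset[OF s])
  with zy obtain u where u: "z = e u" "prefix u v"
    by (auto elim!: tree_memE)
  with v have "s @ u \<in> W"
    using prefix_closed[of "s @ u" "s @ v"] by simp
  then have "e (s @ u) \<in> Field (upset tree (e s))"
    by (auto simp: Field_upset[OF s])
  moreover have "z = quotient s (e (s @ u))"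
    using u by simp
  ultimately show "z \<in> quotient s ` Field (upset tree (e s))"
    by blast
qed

lemma semi_upho_tree: "semi_upho tree"
  using poset_tree minimum_tree isoembedding_quotient
  by (auto simp: semi_upho_def has_bottom_def Field_tree)

lemma covers_treeE:
  assumes "covers tree x y"
  obtains u a where "x = e u" "y = e (u @ [a])" "u @ [a] \<in> W"
proof -
  have "(x, y) \<in> tree"
    using assms by (simp add: covers_def)
  then obtain u v where "x = e u" "y = e v"
    by (auto elim!: tree_memE)
  then show thesis
    using assms that by (auto simp: covers_tree)
qed

text \<open>Deleting the prefix \<open>s\<close> from both \<open>s @ w\<close> and
  \<open>s @ w @ [a]\<close> leaves the appended letter \<open>a\<close> unchanged. The colour
  \<open>[a]\<close> is an atom because it is a suffix of a word of \<open>W\<close>.\<close>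

lemma regular_coloring_last_letter: "regular_coloring tree last_letter"
  unfolding regular_coloring_def
proof (intro conjI ballI)
  show "last_letter \<in> cover_pairs tree \<rightarrow> atoms tree"
    using suffix_mem
    by (auto simp: cover_pairs_def last_letter_def atoms_tree elim!: covers_treeE)
  show "last_letter (bottom tree, t) = t" if "t \<in> atoms tree" for t
    using that by (auto simp: atoms_tree last_letter_def)
next
  fix x
  assume "x \<in> Field tree"
  then obtain s where s: "s \<in> W" "x = e s"
    by (auto simp: Field_tree)
  have "last_letter (u, v) = last_letter (quotient s u, quotient s v)"
    if uv: "(u, v) \<in> cover_pairs (upset tree (e s))" for u v
  proof -
    have cov: "covers (upset tree (e s)) u v"
      using uv by (simp add: cover_pairs_def)
    then have "u \<in> Field (upset tree (e s))"
      by (auto simp: covers_def Field_def)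
    then obtain w where w: "u = e (s @ w)"
      by (auto simp: Field_upset[OF s(1)])
    have "trans tree"
      using poset_tree by (simp add: poset_def partial_order_on_def preorder_on_def)
    then have "covers tree u v"
      using cov by (rule covers_upsetD)
    then obtain a where "v = e (s @ w @ [a])"
      using w by (elim covers_treeE) simp
    then show ?thesis
      by (simp add: last_letter_def)
  qed
  then show "\<exists>\<psi>. isoembedding (upset tree x) tree \<psi> \<and>
      (\<forall>(u, v)\<in>cover_pairs (upset tree x). last_letter (u, v) = last_letter (\<psi> u, \<psi> v))"
    using isoembedding_quotient[OF s(1)] s(2) by (intro exI[of _ "quotient s"]) auto
qed

section \<open>Maximal chains and the grading\<close>

lemma maximal_chain_treeE:
  assumes "maximal_chain tree C"
  obtains B where "C = e ` B" "B \<subseteq> W" "[] \<in> B"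
    "\<And>u v. prefix u v \<Longrightarrow> v \<in> B \<Longrightarrow> u \<in> B"
    "\<And>u v. u \<in> B \<Longrightarrow> v \<in> B \<Longrightarrow> prefix u v \<or> prefix v u"
proof -
  have chain: "C \<in> Chains tree" and max: "\<And>D. D \<in> Chains tree \<Longrightarrow> C \<subseteq> D \<Longrightarrow> D = C"
    using assms by (auto simp: maximal_chain_def)
  have "C \<subseteq> Field tree"
    using chain by (auto simp: Chains_def Field_def)
  then have "C \<subseteq> e ` W"
    by (simp add: Field_tree)
  then obtain B where B: "C = e ` B" "B \<subseteq> W"
    by (auto simp: subset_image_iff)
  have comparable: "prefix u v \<or> prefix v u" if "u \<in> B" "v \<in> B" for u v
    using that chain unfolding B(1) by (auto simp: Chains_def)
  \<comment> \<open>Maximality: adding a word comparable to all of \<open>B\<close> keeps a chain,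
    so the word is already there. Prefixes of members are such words, since two prefixes of one word
    are comparable.\<close>
  have insert: "v \<in> B" if "v \<in> W" "\<And>u. u \<in> B \<Longrightarrow> prefix u v \<or> prefix v u" for v
  proof -
    have "e ` insert v B \<in> Chains tree"
      using that comparable B(2) by (auto simp: Chains_def)
    then have "e ` insert v B = C"
      using B(1) by (intro max) auto
    then have "e v \<in> e ` B"
      using B(1) by blast
    then show ?thesis
      by (simp add: inj_image_mem_iff[OF inj_e])
  qed
  show thesis
  proof (rule that)
    show "[] \<in> B"
      using Nil_mem by (intro insert) auto
    show "u \<in> B" if uv: "prefix u v" "v \<in> B" for u v
    proof (rule insert)
      show "u \<in> W"
        using uv B(2) prefix_closed by blast
      show "prefix w u \<or> prefix u w" if "w \<in> B" for w
        using comparable[OF that uv(2)]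
      proof
        assume "prefix w v"
        then show ?thesis
          using uv(1) by (rule prefix_same_cases)
      next
        assume "prefix v w"
        then show ?thesis
          using uv(1) prefix_order.trans by blast
      qed
    qed
  qed (use B comparable in auto)
qed

text \<open>A maximal chain consists of all prefixes of one finite or infinite word, so it meets
  each length up to its bound exactly once.\<close>

lemma N_graded_tree: "N_graded tree level"
  unfolding N_graded_def
proof (intro conjI allI impI)
  show "(\<Union>i. level i) = Field tree"
    by (auto simp: level_def Field_tree)
  show "disjoint_family level"
    by (auto simp: level_def disjoint_family_on_def)
next
  fix C
  assume "maximal_chain tree C"
  then obtain B where B: "C = e ` B" "B \<subseteq> W" "[] \<in> B"
    and closed: "\<And>u v. prefix u v \<Longrightarrow> v \<in> B \<Longrightarrow> u \<in> B"
    and comparable: "\<And>u v. u \<in> B \<Longrightarrow> v \<in> B \<Longrightarrow> prefix u v \<or> prefix v u"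
    by (rule maximal_chain_treeE) blast
  \<comment> \<open>The unique word of length \<open>i\<close> in \<open>B\<close>, provided that
    \<open>B\<close> has a word of length at least \<open>i\<close>; otherwise an arbitrary value,
    so the facts below carry a witness \<open>v\<close>.\<close>
  define p where "p i = (SOME u. u \<in> B \<and> length u = i)" for i
  have p: "p i \<in> B \<and> length (p i) = i" if "v \<in> B" "i \<le> length v" for v i
    unfolding p_def
  proof (rule someI)
    show "take i v \<in> B \<and> length (take i v) = i"
      using that closed[OF take_is_prefix] by simp
  qed
  \<comment> \<open>Comparable words of equal length coincide.\<close>
  have p_length: "p (length v) = v" if "v \<in> B" for v
    using p[OF that order_refl] comparable[of "p (length v)" v] that
    by (metis append_Nil2 append_eq_append_conv prefix_def)
  have p_level: "e (p i) \<in> level i" if "v \<in> B" "i \<le> length v" for v i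
    using p[OF that] B(2) by (auto simp: level_def)
  have p_cover: "covers tree (e (p i)) (e (p (Suc i)))" if v: "v \<in> B" "Suc i \<le> length v" for v i
  proof -
    have 1: "p i \<in> B" "length (p i) = i" and 2: "p (Suc i) \<in> B" "length (p (Suc i)) = Suc i"
      using p[OF v(1)] v(2) by auto
    then obtain t where t: "p (Suc i) = p i @ t"
      using comparable[OF 1(1) 2(1)] by (auto simp: prefix_def)
    then have "length t = Suc 0"
      using 1 2 by simp
    then obtain x where "t = [x]"
      by (auto simp: length_Suc_conv)
    then show ?thesis
      using t 2 B(2) by (auto simp: covers_tree)
  qed
  show "(\<exists>p n. C = p ` {..n} \<and> (\<forall>i\<le>n. p i \<in> level i) \<and> (\<forall>i<n. covers tree (p i) (p (Suc i)))) \<or>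
      (\<exists>p. C = range p \<and> (\<forall>i. p i \<in> level i) \<and> (\<forall>i. covers tree (p i) (p (Suc i))))"
  \<comment> \<open>A longest word in \<open>B\<close> gives a finite chain; without one, lengths in
    \<open>B\<close> are unbounded and the chain is infinite.\<close>
  proof (cases "\<exists>v\<in>B. \<forall>u\<in>B. length u \<le> length v")
    case True
    then obtain v where v: "v \<in> B" "\<And>u. u \<in> B \<Longrightarrow> length u \<le> length v"
      by blast
    have "B \<subseteq> p ` {..length v}"
    proof
      fix u
      assume "u \<in> B"
      then show "u \<in> p ` {..length v}"
        using p_length v(2) by (intro image_eqI[of _ _ "length u"]) auto
    qed
    then have "B = p ` {..length v}"
      using p[OF v(1)] by auto
    then have "C = (\<lambda>i. e (p i)) ` {..length v}"
      using B(1) by auto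
    then show ?thesis
      using p_level[OF v(1)] p_cover[OF v(1)]
      by (intro disjI1 exI[of _ "\<lambda>i. e (p i)"] exI[of _ "length v"]) auto
  next
    case False
    have long: "\<exists>v\<in>B. i \<le> length v" for i
    proof (induction i)
      case 0
      then show ?case
        using B(3) by auto
    next
      case (Suc i)
      then obtain v where "v \<in> B" "i \<le> length v"
        by blast
      moreover obtain u where "u \<in> B" "length v < length u"
        using False \<open>v \<in> B\<close> by (auto simp: not_le)
      ultimately show ?case
        by (intro bexI[of _ u]) auto
    qed
    have "p i \<in> B" for i
      using long[of i] p by blast
    moreover have "u \<in> range p" if "u \<in> B" for u
      using p_length[OF that] by (metis rangeI)
    ultimately have "B = range p"
      by blast
    then have "C = range (\<lambda>i. e (p i))"
      using B(1) by auto
    then show ?thesis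
      using p_level p_cover long by (intro disjI2 exI[of _ "\<lambda>i. e (p i)"]) blast
  qed
qed

lemma regular_semi_upho_tree:
  assumes "\<And>n. finite {u \<in> W. length u = n}"
  shows "regular_semi_upho tree level"
  using assms semi_upho_tree N_graded_tree regular_coloring_last_letter
  by (auto simp: regular_semi_upho_def finite_type_def level_def)

lemma card_level: "card (level n) = card {u \<in> W. length u = n}"
  unfolding level_def by (intro card_image) (auto simp: inj_on_def)

end

section \<open>The language of a log-concave sequence\<close>

text \<open>A positional numeral whose digit at position \<open>i\<close> has place value
  \<open>a i\<close>.\<close>

definition word_value :: "(nat \<Rightarrow> nat) \<Rightarrow> nat list \<Rightarrow> nat" where
  "word_value a xs = (\<Sum>i<length xs. xs ! i * a i)"

text \<open>For strictly increasing \<open>a\<close> with \<open>a 0 = 1\<close> these are the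
  greedy expansions, padded with zeros. Bounding every prefix builds prefix closure into the
  definition.\<close>

definition admissible_words :: "(nat \<Rightarrow> nat) \<Rightarrow> nat list set" where
  "admissible_words a = {xs. \<forall>k\<le>length xs. word_value a (take k xs) < a k}"

lemma word_value_Nil [simp]: "word_value a [] = 0"
  by (simp add: word_value_def)

section \<open>Counting words by their values\<close>

lemma word_value_snoc [simp]: "word_value a (xs @ [x]) = word_value a xs + x * a (length xs)"
  by (simp add: word_value_def nth_append)

lemma word_value_Cons: "word_value a (x # xs) = x * a 0 + word_value (\<lambda>i. a (Suc i)) xs"
  by (simp add: word_value_def sum.lessThan_Suc_shift del: sum.lessThan_Suc)

lemma admissible_snoc:
  "xs @ [x] \<in> admissible_words a \<longleftrightarrow>
    xs \<in> admissible_words a \<and> word_value a xs + x * a (length xs) < a (Suc (length xs))"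
  by (auto simp: admissible_words_def le_Suc_eq)

lemma admissible_prefix: "xs @ ys \<in> admissible_words a \<Longrightarrow> xs \<in> admissible_words a"
  by (induction ys rule: rev_induct) (auto simp: admissible_snoc simp flip: append_assoc)

text \<open>This yields the size of each rank level, \<open>a n\<close>, and its finiteness.\<close>

lemma bij_betw_word_value:
  assumes "a 0 = 1" and zero: "\<And>n. a n = 0 \<Longrightarrow> a (Suc n) = 0"
  shows "bij_betw (word_value a) {xs \<in> admissible_words a. length xs = n} {..<a n}"
proof (induction n)
  case 0
  have "{xs \<in> admissible_words a. length xs = 0} = {[]}"
    using assms(1) by (auto simp: admissible_words_def)
  then show ?case
    using assms(1) by (auto simp: bij_betw_def)
next
  case (Suc n)
  let ?level = "\<lambda>n. {xs \<in> admissible_words a. length xs = n}"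
  have inj: "inj_on (word_value a) (?level n)" and image: "word_value a ` ?level n = {..<a n}"
    using Suc.IH by (auto simp: bij_betw_def)
  have split: "\<exists>ys y. xs = ys @ [y] \<and> ys \<in> ?level n \<and> word_value a ys < a n \<and>
      word_value a xs = word_value a ys + y * a n \<and> word_value a xs < a (Suc n)"
    if "xs \<in> ?level (Suc n)" for xs
  proof -
    obtain ys y where xs: "xs = ys @ [y]"
      using \<open>xs \<in> ?level (Suc n)\<close> by (cases xs rule: rev_cases) auto
    then have ys: "ys \<in> ?level n" and "word_value a xs < a (Suc n)"
      using \<open>xs \<in> ?level (Suc n)\<close> by (auto simp: admissible_snoc)
    moreover have "word_value a ys < a n"
      using image ys by blast
    ultimately show ?thesis
      using xs by auto
  qed
  show ?case
    unfolding bij_betw_def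
  proof
    show "inj_on (word_value a) (?level (Suc n))"
    proof (rule inj_onI)
      fix xs xs'
      assume "xs \<in> ?level (Suc n)" "xs' \<in> ?level (Suc n)"
        and eq: "word_value a xs = word_value a xs'"
      then obtain ys y ys' y' where
        1: "xs = ys @ [y]" "ys \<in> ?level n" "word_value a ys < a n"
          "word_value a xs = word_value a ys + y * a n" and
        2: "xs' = ys' @ [y']" "ys' \<in> ?level n" "word_value a ys' < a n"
          "word_value a xs' = word_value a ys' + y' * a n"
        using split by meson
      \<comment> \<open>The value of \<open>ys\<close> is below \<open>a n\<close>, so division by
        \<open>a n\<close> recovers it as the remainder and the last digit as the quotient.\<close>
      have "word_value a ys = word_value a xs mod a n" "y = word_value a xs div a n"
        using 1(3) unfolding 1(4) by auto
      moreover have "word_value a ys' = word_value a xs mod a n" "y' = word_value a xs div a n"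
        using 2(3) unfolding eq 2(4) by auto
      ultimately have "ys = ys'" "y = y'"
        using inj_onD[OF inj _ 1(2) 2(2)] by simp_all
      then show "xs = xs'"
        using 1(1) 2(1) by simp
    qed
    have "j \<in> word_value a ` ?level (Suc n)" if j: "j < a (Suc n)" for j
    proof -
      \<comment> \<open>A vanishing \<open>a n\<close> would force \<open>a (Suc n) = 0\<close>,
        leaving no \<open>j\<close>. Positivity puts the remainder \<open>j mod a n\<close> in the
        range covered by the induction hypothesis.\<close>
      have "0 < a n"
        using zero[of n] j by (cases "a n") auto
      then have "j mod a n \<in> word_value a ` ?level n"
        using image by simp
      then obtain ys where ys: "ys \<in> ?level n" "word_value a ys = j mod a n"
        by (metis (no_types, lifting) imageE)
      have "word_value a ys + (j div a n) * a n = j"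
        using ys(2) by simp
      then have "ys @ [j div a n] \<in> ?level (Suc n)" "word_value a (ys @ [j div a n]) = j"
        using ys(1) j by (auto simp: admissible_snoc)
      then show ?thesis
        by (metis (no_types, lifting) imageI)
    qed
    then show "word_value a ` ?level (Suc n) = {..<a (Suc n)}"
      using split by (intro equalityI) (blast, simp add: subset_iff)
  qed
qed

section \<open>Suffix closure from log-concavity\<close>

text \<open>The ratios \<open>a (Suc n) / a n\<close> do not increase; cross-multiplication lets
  terms vanish. The induction step multiplies by \<open>a k\<close>, applies log-concavity at
  \<open>k\<close> and the induction hypothesis, and cancels \<open>a k\<close>.\<close>

lemma log_concave_cross_le:
  fixes a :: "nat \<Rightarrow> nat"
  assumes lc: "\<And>n. a n * a (n + 2) \<le> (a (n + 1))\<^sup>2"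
    and zero: "\<And>n. a n = 0 \<Longrightarrow> a (Suc n) = 0"
    and "i \<le> k"
  shows "a i * a (Suc k) \<le> a (Suc i) * a k"
  using \<open>i \<le> k\<close>
proof (induction k rule: dec_induct)
  case base
  show ?case
    by simp
next
  case (step k)
  show ?case
  proof (cases "a (Suc k) = 0")
    case True
    then show ?thesis
      using zero[of "Suc k"] by simp
  next
    case False
    then have pos: "0 < a k"
      using zero[of k] by (cases "a k") auto
    have "a k * (a i * a (Suc (Suc k))) = a i * (a k * a (k + 2))"
      by simp
    also have "\<dots> \<le> a i * (a (Suc k) * a (Suc k))"
      using lc[of k] by (intro mult_left_mono) (auto simp: power2_eq_square)
    also have "\<dots> = a (Suc k) * (a i * a (Suc k))"
      by simp
    also have "\<dots> \<le> a (Suc k) * (a (Suc i) * a k)"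
      using step.IH by (intro mult_left_mono) auto
    also have "\<dots> = a k * (a (Suc i) * a (Suc k))"
      by simp
    finally show ?thesis
      using pos by simp
  qed
qed

text \<open>Deleting the first letter moves each remaining digit from place value
  \<open>a (Suc i)\<close> to \<open>a i\<close>. Multiplied by \<open>a (Suc k)\<close>, the new
  value is bounded termwise by \<open>a k\<close> times the old one, which is below
  \<open>a (Suc k)\<close>.\<close>

lemma admissible_tl:
  assumes lc: "\<And>n. a n * a (n + 2) \<le> (a (n + 1))\<^sup>2"
    and zero: "\<And>n. a n = 0 \<Longrightarrow> a (Suc n) = 0"
    and adm: "x # xs \<in> admissible_words a"
  shows "xs \<in> admissible_words a"
  unfolding admissible_words_def
proof (intro CollectI allI impI)
  fix k
  assume k: "k \<le> length xs"
  let ?ys = "take k xs"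
  have "word_value a (take (Suc k) (x # xs)) < a (Suc k)"
    using adm k unfolding admissible_words_def by (auto simp del: take_Suc_Cons)
  \<comment> \<open>The contribution \<open>x * a 0\<close> of the deleted letter is nonnegative and
    is dropped.\<close>
  then have less: "word_value (\<lambda>i. a (Suc i)) ?ys < a (Suc k)"
    by (simp add: word_value_Cons)
  then have pos: "0 < a k"
    using zero[of k] by (cases "a k") auto
  have "word_value a ?ys * a (Suc k) = (\<Sum>i<length ?ys. ?ys ! i * (a i * a (Suc k)))"
    by (simp add: word_value_def sum_distrib_right mult.assoc)
  \<comment> \<open>Here \<open>i < k\<close>, because \<open>?ys\<close> has length
    \<open>k\<close>.\<close>
  also have "\<dots> \<le> (\<Sum>i<length ?ys. ?ys ! i * (a (Suc i) * a k))"
    using log_concave_cross_le[of a, OF lc zero] by (intro sum_mono mult_left_mono) auto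
  also have "\<dots> = word_value (\<lambda>i. a (Suc i)) ?ys * a k"
    by (simp add: word_value_def sum_distrib_right mult.assoc)
  also have "\<dots> < a (Suc k) * a k"
    using less pos by simp
  finally show "word_value a ?ys < a k"
    by (simp add: mult.commute)
qed

lemma admissible_suffix:
  assumes "\<And>n. a n * a (n + 2) \<le> (a (n + 1))\<^sup>2" "\<And>n. a n = 0 \<Longrightarrow> a (Suc n) = 0"
  shows "xs @ ys \<in> admissible_words a \<Longrightarrow> ys \<in> admissible_words a"
  by (induction xs) (use admissible_tl[of a, OF assms] in auto)

theorem theorem1p4:
  fixes g :: "int fps"
  assumes "g \<in> {1 + fps_X * h | h. \<forall>n. fps_nth h n \<ge> 0}"
    and "log_concave_fps g"
  shows "regular_semi_upho_function g"
proof -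
  \<comment> \<open>Log-concavity includes nonnegativity, so \<open>nat\<close> loses
    nothing.\<close>
  define a where "a n = nat (fps_nth g n)" for n
  have g_nth: "fps_nth g n = int (a n)" for n
    using assms(2) by (simp add: a_def log_concave_fps_def)
  have a0: "a 0 = 1"
    using assms(1) by (auto simp: a_def)
  have lc: "a n * a (n + 2) \<le> (a (n + 1))\<^sup>2" for n
  proof -
    have "int (a n) * int (a (n + 2)) \<le> (int (a (n + 1)))\<^sup>2"
      using assms(2) unfolding log_concave_fps_def g_nth by blast
    then show ?thesis
      by (metis of_nat_le_iff of_nat_mult of_nat_power)
  qed
  have zero: "a (Suc n) = 0" if "a n = 0" for n
  proof -
    have "fps_nth g (Suc n) = 0"
      using assms(2) that unfolding log_concave_fps_def by (auto simp: g_nth)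
    then show ?thesis
      by (simp add: g_nth)
  qed
  \<comment> \<open>The encoding \<open>to_nat\<close> puts the tree on the natural numbers.
    Log-concavity enters through suffix closure only.\<close>
  interpret factorial_language "admissible_words a" "to_nat :: nat list \<Rightarrow> nat"
  proof
    show "[] \<in> admissible_words a"
      using a0 by (simp add: admissible_words_def)
    show "u \<in> admissible_words a" if "u @ v \<in> admissible_words a" for u v
      using that by (rule admissible_prefix)
    show "v \<in> admissible_words a" if "u @ v \<in> admissible_words a" for u v
      using lc zero that by (rule admissible_suffix)
    show "inj (to_nat :: nat list \<Rightarrow> nat)"
      by simp
  qed
  have bij: "bij_betw (word_value a) {xs \<in> admissible_words a. length xs = n} {..<a n}" for n
    using a0 zero by (rule bij_betw_word_value)
  have "regular_semi_upho tree level"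
    using bij_betw_finite[OF bij] by (intro regular_semi_upho_tree) simp
  moreover have "g = rank_gf level"
    using bij_betw_same_card[OF bij] by (simp add: fps_eq_iff rank_gf_def card_level g_nth)
  ultimately show ?thesis
    unfolding regular_semi_upho_function_def by blast
qed

end
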